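(* Let $K$ be a finite simplicial complex, let $S$ be an isolated invariant set under a multivector field $\mathcal{V}$ on $K$, and let $\mathcal{V}'$ be an atomic coarsening of $\mathcal{V}$ where the unique merged multivector $V\in\mathcal{V}'\setminus\mathcal{V}$ satisfies $V\cap S\neq\emptyset$ and $V\not\subseteq S$. Let $A:=\langle S\cup V\rangle_{\mathcal{V}'}$. If $S\neq\mathrm{Inv}_{\mathcal{V}}(A)$, then there does not exist an isolated invariant set $S'$ under $\mathcal{V}'$ for which there is a pair $(P,E)$ that is an index pair for both $S$ under $\mathcal{V}$ and $S'$ under $\mathcal{V}'$ (so that $\mathrm{Inv}_{\mathcal{V}}(P\setminus E)=S$ and $\mathrm{Inv}_{\mathcal{V}'}(P\setminus E)=S'$).
   Context: $K$ is a finite simplicial complex, viewed as the finite set of its (nonempty) simplices; $\leq$ is the face relation. Homology is simplicial homology with coefficients in a fixed finite field. Closure and mouth: $\mathrm{cl}(\sigma) = \{\tau \in K : \tau \leq \sigma\}$, $\mathrm{cl}(A) = \bigcup_{\sigma\in A}\mathrm{cl}(\sigma)$ for $A\subseteq K$; $A$ is closed if $A=\mathrm{cl}(A)$; $\mathrm{mo}(A) = \mathrm{cl}(A)\setminus A$. A set $A\subseteq K$ is convex if $\sigma\leq\rho\leq\tau$ with $\sigma,\tau\in A$, $\rho\in K$ implies $\rho\in A$. A multivector is a convex subset of $K$; a multivector field on $K$ is a partition of $K$ into multivectors. $[\sigma]_{\mathcal{V}}$ is the unique multivector of $\mathcal{V}$ containing $\sigma$. A multivector $V$ is critical if $H(\mathrm{cl}(V),\mathrm{mo}(V))\neq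 0$. A set $A\subseteq K$ is $\mathcal{V}$-compatible if it is a union of multivectors of $\mathcal{V}$. Dynamics: $F_{\mathcal{V}}(\sigma)=\mathrm{cl}(\sigma)\cup[\sigma]_{\mathcal{V}}$, and $F_{\mathcal{V}}(A)=\bigcup_{\sigma\in A}F_{\mathcal{V}}(\sigma)$. A path is a map $\rho:\mathbb{Z}\cap[0,n]\to K$ with $\rho(i+1)\in F_{\mathcal{V}}(\rho(i))$ for $0\le i\le n-1$; a solution is a map $\rho:\mathbb{Z}\to K$ with $\rho(i+1)\in F_{\mathcal{V}}(\rho(i))$ for all $i\in\mathbb{Z}$. A solution $\rho$ is essential if for every $i$ with $[\rho(i)]_{\mathcal{V}}$ not critical there exist $i^-<i<i^+$ with $[\rho(i^-)]_{\mathcal{V}}\neq[\rho(i)]_{\mathcal{V}}\neq[\rho(i^+)]_{\mathcal{V}}$. Invariant sets: $\mathrm{Inv}_{\mathcal{V}}(A)$ is the set of $\sigma\in A$ for which there is an essential solution $\rho:\mathbb{Z}\to A$ (under $\mathcal{V}$) with $\rho(i)=\sigma$ for some $i$. $S$ is an invariant set under $\mathcal{V}$ if $S=\mathrm{Inv}_{\mathcal{V}}(S)$. An invariant set $S$ is an isolated invariant set under $\mathcal{V}$ if there is a closed set $N$ (an isolating set for $S$) with $F_{\mathcal{V}}(S)\subseteq N$ such that every path $\rho:\mathbb{Z}\cap[0,n]\to N$ with $\rho(0),\rho(n)\in S$ has its whole image in $S$. Index pair: for an isolated invariant set $S$ under $\mathcal{V}$ and closed sets $E\subseteq P\subseteq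 K$, $(P,E)$ is an index pair for $S$ (under $\mathcal{V}$) if (1) $F_{\mathcal{V}}(P\setminus E)\subseteq P$; (2) $F_{\mathcal{V}}(E)\cap P\subseteq E$; (3) $S=\mathrm{Inv}_{\mathcal{V}}(P\setminus E)$. Atomic coarsening: $\mathcal{V}'$ is an atomic coarsening of $\mathcal{V}$ if each multivector of $\mathcal{V}$ is contained in a multivector of $\mathcal{V}'$, $|\mathcal{V}'\setminus\mathcal{V}|=1$ and $|\mathcal{V}\setminus\mathcal{V}'|=2$. The unique element of $\mathcal{V}'\setminus\mathcal{V}$ is the merged multivector. $\langle S\cup V\rangle_{\mathcal{V}'}$ denotes the intersection of all $\mathcal{V}'$-compatible and convex subsets of $K$ that contain $S\cup V$. *)

theory Defs
  imports "HOL-Algebra.Coset" "HOL-Algebra.Elementary_Groups" "HOL-Library.Disjoint_Sets"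
begin

section \<open>Finite simplicial complexes\<close>

definition finite_simplicial_complex :: "'v set set \<Rightarrow> bool" where
  "finite_simplicial_complex K \<longleftrightarrow>
     finite K \<and>
     (\<forall>\<sigma>\<in>K. finite \<sigma> \<and> \<sigma> \<noteq> {} \<and> (\<forall>\<tau>. \<tau> \<subseteq> \<sigma> \<and> \<tau> \<noteq> {} \<longrightarrow> \<tau> \<in> K))"

definition cl :: "'v set set \<Rightarrow> 'v set set \<Rightarrow> 'v set set" where
  "cl K A = (\<Union>\<sigma>\<in>A. {\<tau> \<in> K. \<tau> \<subseteq> \<sigma>})"

definition closed_in :: "'v set set \<Rightarrow> 'v set set \<Rightarrow> bool" where
  "closed_in K A \<longleftrightarrow> A \<subseteq> K \<and> A = cl K A"

definition mo :: "'v set set \<Rightarrow> 'v set set \<Rightarrow> 'v set set" where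
  "mo K A = cl K A - A"

definition convex_in :: "'v set set \<Rightarrow> 'v set set \<Rightarrow> bool" where
  "convex_in K A \<longleftrightarrow> A \<subseteq> K \<and>
     (\<forall>\<sigma>\<in>A. \<forall>\<tau>\<in>A. \<forall>\<rho>\<in>K. \<sigma> \<subseteq> \<rho> \<and> \<rho> \<subseteq> \<tau> \<longrightarrow> \<rho> \<in> A)"


section \<open>Relative simplicial homology\<close>

text \<open>
  Oriented simplicial chains over a field: an ordered simplex is a list of distinct vertices,
  and a \<open>p\<close>-chain of the complex \<open>X\<close> assigns a coefficient to each ordered \<open>p\<close>-simplex of \<open>X\<close>
  (and \<open>0\<close> to all other lists), changing sign under every transposition of vertices. This is the
  usual description of chains as functions on oriented simplices that take opposite values on
  opposite orientations; it needs no order on the vertices. The oriented simplex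
  \<open>[v\<^sub>0,\<dots>,v\<^sub>p]\<close> corresponds to the chain that is the sign of the permutation on reorderings
  of \<open>[v\<^sub>0,\<dots>,v\<^sub>p]\<close> and zero elsewhere.
\<close>

definition simplicial_chain :: "nat \<Rightarrow> 'v set set \<Rightarrow> ('v list \<Rightarrow> 'f::field) \<Rightarrow> bool" where
  "simplicial_chain p X c \<longleftrightarrow>
     (\<forall>xs. c xs \<noteq> 0 \<longrightarrow> distinct xs \<and> length xs = Suc p \<and> set xs \<in> X) \<and>
     (\<forall>xs i j. i < j \<and> j < length xs \<longrightarrow> c (xs[i := xs ! j, j := xs ! i]) = - c xs)"

text \<open>
  The usual boundary \<open>\<partial>[v\<^sub>0,\<dots>,v\<^sub>p] = (\<Sum>i\<le>p. (-1)^i [v\<^sub>0,\<dots>,v\<^sub>i\<^sub>-\<^sub>1,v\<^sub>i\<^sub>+\<^sub>1,\<dots>,v\<^sub>p])\<close>, extended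
  linearly and written in coefficients: moving \<open>v\<^sub>i\<close> to the front of \<open>[v\<^sub>0,\<dots>,v\<^sub>p]\<close> costs the sign
  \<open>(-1)^i\<close>, so the coefficient of \<open>\<partial>c\<close> at \<open>ys\<close> is the sum of \<open>c (v # ys)\<close> over all vertices \<open>v\<close>.
  The sum is finite for chains of a finite complex. In degree \<open>0\<close> the boundary is zero (homology
  is not reduced).
\<close>

definition simplicial_boundary :: "nat \<Rightarrow> ('v list \<Rightarrow> 'f::field) \<Rightarrow> 'v list \<Rightarrow> 'f" where
  "simplicial_boundary p c ys = (if p = 0 then 0 else \<Sum>v | c (v # ys) \<noteq> 0. c (v # ys))"

text \<open>
  As for singular homology in the library, the homology of a pair \<open>(X, Y)\<close> of complexes is the
  group of relative cycles modulo the relative boundaries; the truncation \<open>0 - 1 = 0\<close> is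
  harmless because boundaries of \<open>0\<close>-chains vanish. Only the additive group of the homology
  vector space is recorded.
\<close>

definition rel_cycles :: "nat \<Rightarrow> 'v set set \<Rightarrow> 'v set set \<Rightarrow> ('v list \<Rightarrow> 'f::field) set" where
  "rel_cycles p X Y =
     {c. simplicial_chain p X c \<and> simplicial_chain (p - 1) Y (simplicial_boundary p c)}"

definition rel_boundaries :: "nat \<Rightarrow> 'v set set \<Rightarrow> 'v set set \<Rightarrow> ('v list \<Rightarrow> 'f::field) set" where
  "rel_boundaries p X Y =
     {\<lambda>ys. simplicial_boundary (Suc p) d ys + e ys | d e.
        simplicial_chain (Suc p) X d \<and> simplicial_chain p Y e}"

definition rel_cycle_group ::
    "nat \<Rightarrow> 'v set set \<Rightarrow> 'v set set \<Rightarrow> ('v list \<Rightarrow> 'f::field) monoid" where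
  "rel_cycle_group p X Y =
     \<lparr>carrier = rel_cycles p X Y, mult = (\<lambda>c d xs. c xs + d xs), one = (\<lambda>xs. 0)\<rparr>"

definition rel_homology_group ::
    "nat \<Rightarrow> 'v set set \<Rightarrow> 'v set set \<Rightarrow> ('v list \<Rightarrow> 'f::field) set monoid" where
  "rel_homology_group p X Y = rel_cycle_group p X Y Mod rel_boundaries p X Y"

text \<open>
  The homology groups really are groups for every pair of finite complexes, in particular for
  the pairs \<open>(cl V, mo V)\<close> used below.
\<close>

lemma sum_alternating_eq_0:
  assumes "finite A" and "\<And>v w. f v w = - f w v" and "\<And>v. f v v = (0::'f::field)"
  shows "(\<Sum>v\<in>A. \<Sum>w\<in>A. f v w) = 0"
  using assms(1)
proof induction
  case (insert a A)
  have "(\<Sum>v\<in>A. f v a) = - (\<Sum>w\<in>A. f a w)"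
    by (subst assms(2)) (simp add: sum_negf)
  then show ?case using insert assms(3) by (simp add: sum.distrib)
qed simp

lemma simplicial_chain_supp:
  "simplicial_chain p X c \<Longrightarrow> c xs \<noteq> 0 \<Longrightarrow> distinct xs \<and> length xs = Suc p \<and> set xs \<in> X"
  unfolding simplicial_chain_def by blast

lemma simplicial_chain_swap:
  "simplicial_chain p X c \<Longrightarrow> i < j \<and> j < length xs \<Longrightarrow> c (xs[i := xs ! j, j := xs ! i]) = - c xs"
  unfolding simplicial_chain_def by blast

lemma simplicial_boundary_eq:
  assumes "finite_simplicial_complex X" "simplicial_chain p X c" "p > 0"
  shows "simplicial_boundary p c ys = (\<Sum>v\<in>\<Union>X. c (v # ys))"
proof -
  have fin: "finite (\<Union>X)" using assms(1) by (auto simp: finite_simplicial_complex_def)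
  have sub: "{v. c (v # ys) \<noteq> 0} \<subseteq> \<Union>X"
  proof
    fix v assume "v \<in> {v. c (v # ys) \<noteq> 0}"
    then have "set (v # ys) \<in> X" using simplicial_chain_supp[OF assms(2)] by blast
    then show "v \<in> \<Union>X" by (rule UnionI) simp
  qed
  have "(\<Sum>v | c (v # ys) \<noteq> 0. c (v # ys)) = (\<Sum>v\<in>\<Union>X. c (v # ys))"
    by (rule sum.mono_neutral_left[OF fin sub]) simp
  then show ?thesis using assms(3) by (simp add: simplicial_boundary_def)
qed

lemma simplicial_chain_boundary:
  assumes X: "finite_simplicial_complex X" and c: "simplicial_chain p X c"
  shows "simplicial_chain (p - 1) X (simplicial_boundary p c)"
proof (cases "p = 0")
  case True
  then show ?thesis by (simp add: simplicial_chain_def simplicial_boundary_def)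
next
  case False
  then have b: "simplicial_boundary p c ys = (\<Sum>v\<in>\<Union>X. c (v # ys))" for ys using simplicial_boundary_eq[OF X c] by simp
  show ?thesis unfolding simplicial_chain_def
  proof (intro conjI allI impI)
    fix ys assume "simplicial_boundary p c ys \<noteq> 0"
    then obtain v where "c (v # ys) \<noteq> 0" unfolding b by (meson sum.neutral)
    note s' = simplicial_chain_supp[OF c this]
    show "distinct ys" "length ys = Suc (p - 1)" using s' False by auto
    have "set ys \<noteq> {}" using s' False by auto
    moreover have "set ys \<subseteq> set (v # ys)" by auto
    ultimately show "set ys \<in> X" using s' X unfolding finite_simplicial_complex_def by blast
  next
    fix ys i j assume "i < j \<and> j < length (ys::'a list)"
    then have "c (v # ys[i := ys ! j, j := ys ! i]) = - c (v # ys)" for v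
      using simplicial_chain_swap[OF c, of "Suc i" "Suc j" "v # ys"] by simp
    then show "simplicial_boundary p c (ys[i := ys ! j, j := ys ! i]) = - simplicial_boundary p c ys"
      unfolding b by (simp add: sum_negf)
  qed
qed

lemma simplicial_boundary_boundary:
  assumes X: "finite_simplicial_complex X" and c: "simplicial_chain p X c"
  shows "simplicial_boundary (p - 1) (simplicial_boundary p c) = (\<lambda>_. 0)"
proof (cases "p - 1 = 0")
  case True then show ?thesis by (auto simp: simplicial_boundary_def)
next
  case False
  have f: "finite (\<Union>X)" using X by (auto simp: finite_simplicial_complex_def)
  have s: "c (v # v # zs) = 0" for v zs
    using simplicial_chain_supp[OF c, of "v # v # zs"] by auto
  have a: "c (v # w # zs) = - c (w # v # zs)" for v w zs
    using simplicial_chain_swap[OF c, of 0 1 "w # v # zs"] by simp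
  show ?thesis
  proof
    fix zs
    have "simplicial_boundary (p - 1) (simplicial_boundary p c) zs
       = (\<Sum>v\<in>\<Union>X. \<Sum>w\<in>\<Union>X. c (w # v # zs))"
      using False simplicial_boundary_eq[OF X c] simplicial_boundary_eq[OF X simplicial_chain_boundary[OF X c]] by simp
    also have "\<dots> = 0" by (rule sum_alternating_eq_0[OF f], rule a, rule s)
    finally show "simplicial_boundary (p - 1) (simplicial_boundary p c) zs = 0" .
  qed
qed

lemma simplicial_chain_add:
  assumes c: "simplicial_chain p X c" and d: "simplicial_chain p X d"
  shows "simplicial_chain p X (\<lambda>xs. c xs + d xs)"
  unfolding simplicial_chain_def
proof (intro conjI allI impI)
  fix xs assume "c xs + d xs \<noteq> 0"
  then have "c xs \<noteq> 0 \<or> d xs \<noteq> 0" by auto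
  then have "distinct xs \<and> length xs = Suc p \<and> set xs \<in> X"
    using simplicial_chain_supp[OF c] simplicial_chain_supp[OF d] by blast
  then show "distinct xs" "length xs = Suc p" "set xs \<in> X" by simp_all
next
  fix xs :: "'a list" and i j assume *: "i < j \<and> j < length xs"
  show "c (xs[i := xs ! j, j := xs ! i]) + d (xs[i := xs ! j, j := xs ! i]) = - (c xs + d xs)"
    unfolding simplicial_chain_swap[OF c *] simplicial_chain_swap[OF d *] by simp
qed

lemma simplicial_chain_minus:
  assumes c: "simplicial_chain p X c"
  shows "simplicial_chain p X (\<lambda>xs. - c xs)"
  unfolding simplicial_chain_def
proof (intro conjI allI impI)
  fix xs assume "- c xs \<noteq> 0"
  then show "distinct xs" "length xs = Suc p" "set xs \<in> X"
    using simplicial_chain_supp[OF c, of xs] by simp_all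
next
  fix xs :: "'a list" and i j assume *: "i < j \<and> j < length xs"
  show "- c (xs[i := xs ! j, j := xs ! i]) = - (- c xs)"
    unfolding simplicial_chain_swap[OF c *] ..
qed

lemma simplicial_chain_0: "simplicial_chain p X (\<lambda>xs. 0)"
  unfolding simplicial_chain_def by auto

lemma simplicial_chain_mono: "Y \<subseteq> X \<Longrightarrow> simplicial_chain p Y c \<Longrightarrow> simplicial_chain p X c"
  unfolding simplicial_chain_def by blast

lemma simplicial_boundary_add:
  assumes "finite_simplicial_complex X" "simplicial_chain p X c" "simplicial_chain p X d"
  shows "simplicial_boundary p (\<lambda>xs. c xs + d xs) = (\<lambda>ys. simplicial_boundary p c ys + simplicial_boundary p d ys)"
proof (cases "p = 0")
  case False
  show ?thesis using simplicial_boundary_eq[OF assms(1,2)] simplicial_boundary_eq[OF assms(1,3)] simplicial_boundary_eq[OF assms(1) simplicial_chain_add[OF assms(2,3)]] False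
    by (simp add: sum.distrib fun_eq_iff)
qed (simp add: simplicial_boundary_def fun_eq_iff)

lemma simplicial_boundary_minus: "simplicial_boundary p (\<lambda>xs. - c xs) = (\<lambda>ys. - simplicial_boundary p c ys)"
  by (simp add: simplicial_boundary_def fun_eq_iff sum_negf)

lemma simplicial_boundary_0: "simplicial_boundary p (\<lambda>xs. 0) = (\<lambda>ys. 0)"
  by (simp add: simplicial_boundary_def fun_eq_iff)

lemma comm_group_rel_cycle_group:
  assumes X: "finite_simplicial_complex X"
  shows "comm_group (rel_cycle_group p X Y :: ('v list \<Rightarrow> 'f::field) monoid)"
proof (rule comm_groupI)
  let ?G = "rel_cycle_group p X Y :: ('v list \<Rightarrow> 'f) monoid"
  show "\<one>\<^bsub>?G\<^esub> \<in> carrier ?G"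
    by (simp add: rel_cycle_group_def rel_cycles_def simplicial_chain_0 simplicial_boundary_0)
  fix x assume x: "x \<in> carrier ?G"
  show "\<one>\<^bsub>?G\<^esub> \<otimes>\<^bsub>?G\<^esub> x = x"
    by (simp add: rel_cycle_group_def)
  show "\<exists>y\<in>carrier ?G. y \<otimes>\<^bsub>?G\<^esub> x = \<one>\<^bsub>?G\<^esub>"
    using x by (intro bexI[of _ "\<lambda>xs. - x xs"])
      (simp_all add: rel_cycle_group_def rel_cycles_def simplicial_boundary_minus simplicial_chain_minus)
  fix y assume y: "y \<in> carrier ?G"
  show "x \<otimes>\<^bsub>?G\<^esub> y = y \<otimes>\<^bsub>?G\<^esub> x"
    by (simp add: rel_cycle_group_def add.commute)
  show "x \<otimes>\<^bsub>?G\<^esub> y \<in> carrier ?G"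
    using x y
    by (simp add: rel_cycle_group_def rel_cycles_def simplicial_chain_add simplicial_boundary_add[OF X])
  fix z
  show "x \<otimes>\<^bsub>?G\<^esub> y \<otimes>\<^bsub>?G\<^esub> z = x \<otimes>\<^bsub>?G\<^esub> (y \<otimes>\<^bsub>?G\<^esub> z)"
    by (simp add: rel_cycle_group_def add.assoc)
qed

lemma rel_boundaries_subset_rel_cycles:
  assumes X: "finite_simplicial_complex X" and Y: "finite_simplicial_complex Y" "Y \<subseteq> X"
  shows "rel_boundaries p X Y \<subseteq> rel_cycles p X Y"
proof
  fix c :: "'a list \<Rightarrow> 'b" assume "c \<in> rel_boundaries p X Y"
  then obtain d e where c: "c = (\<lambda>ys. simplicial_boundary (Suc p) d ys + e ys)"
    and d: "simplicial_chain (Suc p) X d" and e: "simplicial_chain p Y e"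
    by (auto simp: rel_boundaries_def)
  note d1 = simplicial_chain_boundary[OF X d, simplified] and e1 = simplicial_chain_mono[OF Y(2) e]
  have "simplicial_boundary p c = simplicial_boundary p e"
    unfolding c simplicial_boundary_add[OF X d1 e1] using simplicial_boundary_boundary[OF X d] by simp
  then show "c \<in> rel_cycles p X Y"
    using simplicial_chain_add[OF d1 e1] simplicial_chain_boundary[OF Y(1) e] unfolding rel_cycles_def c by simp
qed

lemma rel_boundariesI:
  assumes "simplicial_chain (Suc p) X d" "simplicial_chain p Y e"
    and "c = (\<lambda>ys. simplicial_boundary (Suc p) d ys + e ys)"
  shows "c \<in> rel_boundaries p X Y"
  unfolding rel_boundaries_def using assms by blast

lemma comm_group_rel_homology_group:
  assumes X: "finite_simplicial_complex X" and Y: "finite_simplicial_complex Y" "Y \<subseteq> X"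
  shows "comm_group (rel_homology_group p X Y :: ('v list \<Rightarrow> 'f::field) set monoid)"
proof -
  let ?G = "rel_cycle_group p X Y :: ('v list \<Rightarrow> 'f) monoid"
  let ?B = "rel_boundaries p X Y :: ('v list \<Rightarrow> 'f) set"
  interpret G: comm_group ?G by (rule comm_group_rel_cycle_group[OF X])
  have sub: "?B \<subseteq> carrier ?G"
    using rel_boundaries_subset_rel_cycles[OF assms] by (simp add: rel_cycle_group_def)
  have "subgroup ?B ?G"
  proof (rule G.subgroupI[OF sub])
    have "(\<lambda>_. 0) \<in> ?B"
      by (rule rel_boundariesI[OF simplicial_chain_0 simplicial_chain_0])
        (simp add: simplicial_boundary_0)
    then show "?B \<noteq> {}" by blast
  next
    fix a assume a: "a \<in> ?B"
    then obtain d e where eq: "a = (\<lambda>ys. simplicial_boundary (Suc p) d ys + e ys)"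
      and d: "simplicial_chain (Suc p) X d" and e: "simplicial_chain p Y e"
      unfolding rel_boundaries_def by blast
    have m: "(\<lambda>ys. - a ys) \<in> ?B"
      by (rule rel_boundariesI[OF simplicial_chain_minus[OF d] simplicial_chain_minus[OF e]])
        (simp add: eq simplicial_boundary_minus)
    have "inv\<^bsub>?G\<^esub> a = (\<lambda>ys. - a ys)"
      by (rule G.inv_equality[OF _ subsetD[OF sub a] subsetD[OF sub m]])
        (simp add: rel_cycle_group_def)
    with m show "inv\<^bsub>?G\<^esub> a \<in> ?B" by simp
  next
    fix a b assume a: "a \<in> ?B" and b: "b \<in> ?B"
    from a obtain d e where a_eq: "a = (\<lambda>ys. simplicial_boundary (Suc p) d ys + e ys)"
      and d: "simplicial_chain (Suc p) X d" and e: "simplicial_chain p Y e"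
      unfolding rel_boundaries_def by blast
    from b obtain d' e' where b_eq: "b = (\<lambda>ys. simplicial_boundary (Suc p) d' ys + e' ys)"
      and d': "simplicial_chain (Suc p) X d'" and e': "simplicial_chain p Y e'"
      unfolding rel_boundaries_def by blast
    show "a \<otimes>\<^bsub>?G\<^esub> b \<in> ?B"
      by (rule rel_boundariesI[OF simplicial_chain_add[OF d d'] simplicial_chain_add[OF e e']])
        (unfold simplicial_boundary_add[OF X d d'] a_eq b_eq, simp add: rel_cycle_group_def add_ac)
  qed
  then show ?thesis unfolding rel_homology_group_def by (rule G.abelian_FactGroup)
qed

lemma finite_simplicial_complex_subset:
  assumes K: "finite_simplicial_complex K" and X: "X \<subseteq> K"
    and down: "\<And>\<sigma> \<tau>. \<sigma> \<in> X \<Longrightarrow> \<tau> \<in> K \<Longrightarrow> \<tau> \<subseteq> \<sigma> \<Longrightarrow> \<tau> \<in> X"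
  shows "finite_simplicial_complex X"
  unfolding finite_simplicial_complex_def
proof (intro conjI ballI allI impI)
  show "finite X" using K X finite_subset unfolding finite_simplicial_complex_def by blast
  fix \<sigma> assume \<sigma>: "\<sigma> \<in> X"
  then have "\<sigma> \<in> K" using X by blast
  then show "finite \<sigma>" "\<sigma> \<noteq> {}" using K unfolding finite_simplicial_complex_def by blast+
  fix \<tau> assume \<tau>: "\<tau> \<subseteq> \<sigma> \<and> \<tau> \<noteq> {}"
  then have "\<tau> \<in> K" using K \<open>\<sigma> \<in> K\<close> unfolding finite_simplicial_complex_def by blast
  then show "\<tau> \<in> X" using down[OF \<sigma>] \<tau> by blast
qed

lemma finite_simplicial_complex_cl_mo:
  assumes K: "finite_simplicial_complex K" and V: "convex_in K V"
  shows "finite_simplicial_complex (cl K V)" "finite_simplicial_complex (mo K V)"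
proof -
  show "finite_simplicial_complex (cl K V)"
    by (rule finite_simplicial_complex_subset[OF K]) (unfold cl_def, blast+)
  show "finite_simplicial_complex (mo K V)"
  proof (rule finite_simplicial_complex_subset[OF K])
    show "mo K V \<subseteq> K" unfolding mo_def cl_def by blast
    fix \<sigma> \<tau> assume \<sigma>: "\<sigma> \<in> mo K V" and \<tau>: "\<tau> \<in> K" "\<tau> \<subseteq> \<sigma>"
    from \<sigma> obtain \<rho> where \<rho>: "\<rho> \<in> V" "\<sigma> \<subseteq> \<rho>" and "\<sigma> \<in> K" "\<sigma> \<notin> V"
      unfolding mo_def cl_def by blast
    then have "\<tau> \<notin> V" using V \<tau> unfolding convex_in_def by blast
    moreover have "\<tau> \<subseteq> \<rho>" using \<tau> \<rho> by blast
    ultimately show "\<tau> \<in> mo K V" using \<rho>(1) \<tau>(1) unfolding mo_def cl_def by blast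
  qed
qed

lemma comm_group_rel_homology_group_cl_mo:
  assumes "finite_simplicial_complex K" "convex_in K V"
  shows "comm_group (rel_homology_group p (cl K V) (mo K V) :: ('v list \<Rightarrow> 'f::field) set monoid)"
  by (rule comm_group_rel_homology_group[OF finite_simplicial_complex_cl_mo[OF assms]])
    (auto simp: mo_def)


section \<open>Multivector fields\<close>

definition multivector_field :: "'v set set \<Rightarrow> 'v set set set \<Rightarrow> bool" where
  "multivector_field K \<V> \<longleftrightarrow> partition_on K \<V> \<and> (\<forall>V\<in>\<V>. convex_in K V)"

definition mv_of :: "'v set set set \<Rightarrow> 'v set \<Rightarrow> 'v set set" where
  "mv_of \<V> \<sigma> = (THE V. V \<in> \<V> \<and> \<sigma> \<in> V)"

text \<open>The type argument carries the coefficient field of homology.\<close>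

definition critical :: "'f::field itself \<Rightarrow> 'v set set \<Rightarrow> 'v set set \<Rightarrow> bool" where
  "critical F K V \<longleftrightarrow>
     (\<exists>p. \<not> trivial_group
        (rel_homology_group p (cl K V) (mo K V) :: ('v list \<Rightarrow> 'f) set monoid))"

definition compatible :: "'v set set set \<Rightarrow> 'v set set \<Rightarrow> bool" where
  "compatible \<V> A \<longleftrightarrow> (\<exists>\<W>\<subseteq>\<V>. A = \<Union>\<W>)"

definition atomic_coarsening ::
    "'v set set \<Rightarrow> 'v set set set \<Rightarrow> 'v set set set \<Rightarrow> bool" where
  "atomic_coarsening K \<V> \<V>' \<longleftrightarrow>
     multivector_field K \<V> \<and> multivector_field K \<V>' \<and>
     (\<forall>W\<in>\<V>. \<exists>W'\<in>\<V>'. W \<subseteq> W') \<and>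
     card (\<V>' - \<V>) = 1 \<and> card (\<V> - \<V>') = 2"

definition compatible_convex_hull ::
    "'v set set \<Rightarrow> 'v set set set \<Rightarrow> 'v set set \<Rightarrow> 'v set set" where
  "compatible_convex_hull K \<V> B =
     \<Inter>{A. A \<subseteq> K \<and> compatible \<V> A \<and> convex_in K A \<and> B \<subseteq> A}"


section \<open>Combinatorial dynamics\<close>

definition dyn :: "'v set set \<Rightarrow> 'v set set set \<Rightarrow> 'v set \<Rightarrow> 'v set set" where
  "dyn K \<V> \<sigma> = cl K {\<sigma>} \<union> mv_of \<V> \<sigma>"

definition dyn_image :: "'v set set \<Rightarrow> 'v set set set \<Rightarrow> 'v set set \<Rightarrow> 'v set set" where
  "dyn_image K \<V> A = (\<Union>\<sigma>\<in>A. dyn K \<V> \<sigma>)"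

text \<open>A path of length \<open>n\<close>; the values of \<open>\<rho>\<close> beyond \<open>n\<close> are irrelevant.\<close>

definition is_path ::
    "'v set set \<Rightarrow> 'v set set set \<Rightarrow> nat \<Rightarrow> (nat \<Rightarrow> 'v set) \<Rightarrow> bool" where
  "is_path K \<V> n \<rho> \<longleftrightarrow> (\<forall>i\<le>n. \<rho> i \<in> K) \<and> (\<forall>i<n. \<rho> (Suc i) \<in> dyn K \<V> (\<rho> i))"

definition is_solution :: "'v set set \<Rightarrow> 'v set set set \<Rightarrow> (int \<Rightarrow> 'v set) \<Rightarrow> bool" where
  "is_solution K \<V> \<rho> \<longleftrightarrow> (\<forall>i. \<rho> i \<in> K) \<and> (\<forall>i. \<rho> (i + 1) \<in> dyn K \<V> (\<rho> i))"

definition essential_solution ::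
    "'f::field itself \<Rightarrow> 'v set set \<Rightarrow> 'v set set set \<Rightarrow> (int \<Rightarrow> 'v set) \<Rightarrow> bool" where
  "essential_solution F K \<V> \<rho> \<longleftrightarrow>
     is_solution K \<V> \<rho> \<and>
     (\<forall>i. \<not> critical F K (mv_of \<V> (\<rho> i)) \<longrightarrow>
        (\<exists>j k. j < i \<and> i < k \<and>
           mv_of \<V> (\<rho> j) \<noteq> mv_of \<V> (\<rho> i) \<and> mv_of \<V> (\<rho> i) \<noteq> mv_of \<V> (\<rho> k)))"

definition Inv ::
    "'f::field itself \<Rightarrow> 'v set set \<Rightarrow> 'v set set set \<Rightarrow> 'v set set \<Rightarrow> 'v set set" where
  "Inv F K \<V> A =
     {\<sigma> \<in> A. \<exists>\<rho>. essential_solution F K \<V> \<rho> \<and> (\<forall>i. \<rho> i \<in> A) \<and> (\<exists>i. \<rho> i = \<sigma>)}"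

definition invariant_set ::
    "'f::field itself \<Rightarrow> 'v set set \<Rightarrow> 'v set set set \<Rightarrow> 'v set set \<Rightarrow> bool" where
  "invariant_set F K \<V> S \<longleftrightarrow> S \<subseteq> K \<and> S = Inv F K \<V> S"

definition isolating_set ::
    "'v set set \<Rightarrow> 'v set set set \<Rightarrow> 'v set set \<Rightarrow> 'v set set \<Rightarrow> bool" where
  "isolating_set K \<V> S N \<longleftrightarrow>
     closed_in K N \<and> dyn_image K \<V> S \<subseteq> N \<and>
     (\<forall>n \<rho>. is_path K \<V> n \<rho> \<and> (\<forall>i\<le>n. \<rho> i \<in> N) \<and> \<rho> 0 \<in> S \<and> \<rho> n \<in> S \<longrightarrow> (\<forall>i\<le>n. \<rho> i \<in> S))"

definition isolated_invariant_set ::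
    "'f::field itself \<Rightarrow> 'v set set \<Rightarrow> 'v set set set \<Rightarrow> 'v set set \<Rightarrow> bool" where
  "isolated_invariant_set F K \<V> S \<longleftrightarrow> invariant_set F K \<V> S \<and> (\<exists>N. isolating_set K \<V> S N)"

definition index_pair ::
    "'f::field itself \<Rightarrow> 'v set set \<Rightarrow> 'v set set set \<Rightarrow> 'v set set \<Rightarrow> 'v set set \<Rightarrow> 'v set set \<Rightarrow> bool"
  where
  "index_pair F K \<V> S P E \<longleftrightarrow>
     closed_in K P \<and> closed_in K E \<and> E \<subseteq> P \<and>
     dyn_image K \<V> (P - E) \<subseteq> P \<and>
     dyn_image K \<V> E \<inter> P \<subseteq> E \<and>
     S = Inv F K \<V> (P - E)"

end

theory Submission
  imports Defs
begin

text \<open>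
  The conditions on an index pair \<open>(P, E)\<close> under \<open>\<V>'\<close> force \<open>P - E\<close> to be \<open>\<V>'\<close>-compatible, and
  it is convex as a difference of closed sets. It contains \<open>S\<close>, and therefore also the
  multivector \<open>V\<close>, which meets \<open>S\<close>. Hence \<open>S \<subseteq> A \<subseteq> P - E\<close>, and monotonicity of \<open>Inv\<close> squeezes
  \<open>Inv\<^sub>\<V>(A)\<close> between \<open>Inv\<^sub>\<V>(S) = S\<close> and \<open>Inv\<^sub>\<V>(P - E) = S\<close>.
\<close>

lemma Inv_subset: "Inv F K \<V> A \<subseteq> A"
  unfolding Inv_def by blast

lemma Inv_mono: "A \<subseteq> B \<Longrightarrow> Inv F K \<V> A \<subseteq> Inv F K \<V> B"
  unfolding Inv_def by blast

lemma mv_of_eq: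
  assumes "multivector_field K \<V>" "V \<in> \<V>" "\<sigma> \<in> V"
  shows "mv_of \<V> \<sigma> = V"
  unfolding mv_of_def
proof (rule the_equality)
  have "disjoint \<V>"
    using assms(1) partition_onD2 unfolding multivector_field_def by blast
  then show "W = V" if "W \<in> \<V> \<and> \<sigma> \<in> W" for W
    using that assms(2,3) disjointD[of \<V> W V] by blast
qed (use assms in simp)

lemma closed_in_subset: "closed_in K X \<Longrightarrow> X \<subseteq> K"
  by (simp add: closed_in_def)

lemma closed_in_downward:
  assumes "closed_in K X" "\<tau> \<in> X" "\<rho> \<in> K" "\<rho> \<subseteq> \<tau>"
  shows "\<rho> \<in> X"
proof -
  have "\<rho> \<in> cl K X"
    using assms(2-4) unfolding cl_def by blast
  then show ?thesis
    using assms(1) by (simp add: closed_in_def)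
qed

text \<open>\<open>P\<close> is stable under passing to faces and \<open>K - E\<close> under passing
  to cofaces, so a simplex between two members of \<open>P - E\<close> inherits \<open>P\<close>
  from the upper one and avoidance of \<open>E\<close> from the lower one.\<close>

lemma convex_in_closed_diff:
  assumes P: "closed_in K P" and E: "closed_in K E"
  shows "convex_in K (P - E)"
  unfolding convex_in_def
proof (intro conjI ballI impI)
  show "P - E \<subseteq> K" using closed_in_subset[OF P] by blast
  fix \<sigma> \<tau> \<rho>
  assume \<sigma>: "\<sigma> \<in> P - E" and \<tau>: "\<tau> \<in> P - E" and \<rho>: "\<rho> \<in> K" and le: "\<sigma> \<subseteq> \<rho> \<and> \<rho> \<subseteq> \<tau>"
  have "\<rho> \<in> P"
    using closed_in_downward[OF P _ \<rho>] \<tau> le by blast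
  moreover have "\<rho> \<notin> E"
    using closed_in_downward[OF E, of \<rho> \<sigma>] closed_in_subset[OF P] \<sigma> le by blast
  ultimately show "\<rho> \<in> P - E" by blast
qed

text \<open>Dynamics inside a multivector is reversible: each of its simplices reaches every other
  in one step. So a multivector can neither leave \<open>P\<close> from \<open>P - E\<close> nor
  cross from \<open>E\<close> into \<open>P - E\<close>.\<close>

lemma index_pair_multivector_subset:
  assumes \<V>: "multivector_field K \<V>" and PE: "index_pair F K \<V> S P E"
    and V: "V \<in> \<V>" and \<sigma>: "\<sigma> \<in> V" "\<sigma> \<in> P - E"
  shows "V \<subseteq> P - E"
proof
  fix \<tau> assume \<tau>: "\<tau> \<in> V"
  have image_P: "dyn_image K \<V> (P - E) \<subseteq> P" and image_E: "dyn_image K \<V> E \<inter> P \<subseteq> E"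
    using PE by (simp_all add: index_pair_def)
  have step: "\<beta> \<in> dyn K \<V> \<alpha>" if "\<alpha> \<in> V" "\<beta> \<in> V" for \<alpha> \<beta>
    using that by (simp add: dyn_def mv_of_eq[OF \<V> V])
  have "\<tau> \<in> P"
    using image_P \<sigma>(2) step[OF \<sigma>(1) \<tau>] unfolding dyn_image_def by blast
  \<comment> \<open>The step is now taken backwards, from \<open>\<tau>\<close> to
    \<open>\<sigma>\<close>: if \<open>\<tau>\<close> were in \<open>E\<close>, then
    \<open>\<sigma>\<close>, which lies in \<open>P\<close>, would be forced into
    \<open>E\<close>.\<close>
  moreover have "\<tau> \<notin> E"
    using image_E \<sigma>(2) step[OF \<tau> \<sigma>(1)] unfolding dyn_image_def by blast
  ultimately show "\<tau> \<in> P - E" by blast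
qed

text \<open>A multivector meeting \<open>P - E\<close> lies inside it, so the multivectors contained
  in \<open>P - E\<close> already cover it.\<close>

lemma compatible_index_pair_diff:
  assumes \<V>: "multivector_field K \<V>" and PE: "index_pair F K \<V> S P E"
  shows "compatible \<V> (P - E)"
  unfolding compatible_def
proof (intro exI conjI)
  let ?\<W> = "{W \<in> \<V>. W \<subseteq> P - E}"
  show "?\<W> \<subseteq> \<V>" by blast
  show "P - E = \<Union>?\<W>"
  proof
    show "P - E \<subseteq> \<Union>?\<W>"
    proof
      fix \<sigma> assume \<sigma>: "\<sigma> \<in> P - E"
      have "closed_in K P" using PE by (simp add: index_pair_def)
      then have "\<sigma> \<in> \<Union>\<V>"
        using closed_in_subset \<sigma> \<V> unfolding multivector_field_def partition_on_def by fast
      then obtain W where W: "W \<in> \<V>" "\<sigma> \<in> W" by blast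
      then have "W \<in> ?\<W>" using index_pair_multivector_subset[OF \<V> PE W \<sigma>] by simp
      then show "\<sigma> \<in> \<Union>?\<W>" using W(2) by (rule UnionI)
    qed
  qed (rule Union_least, simp)
qed

lemma compatible_convex_hull_superset: "B \<subseteq> compatible_convex_hull K \<V> B"
  unfolding compatible_convex_hull_def by blast

lemma compatible_convex_hull_least:
  assumes "compatible \<V> A" "convex_in K A" "B \<subseteq> A"
  shows "compatible_convex_hull K \<V> B \<subseteq> A"
  unfolding compatible_convex_hull_def
proof (intro Inter_lower CollectI conjI)
  show "A \<subseteq> K" using assms(2) unfolding convex_in_def by (rule conjunct1)
qed (fact assms)+

text \<open>\<open>P - E\<close> is itself one of the sets whose intersection is the hull.\<close>

lemma compatible_convex_hull_subset_index_pair_diff: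
  assumes "multivector_field K \<V>" "index_pair F K \<V> S P E" "B \<subseteq> P - E"
  shows "compatible_convex_hull K \<V> B \<subseteq> P - E"
proof (rule compatible_convex_hull_least)
  show "compatible \<V> (P - E)"
    using assms(1,2) by (rule compatible_index_pair_diff)
  have "closed_in K P" "closed_in K E"
    using assms(2) by (simp_all add: index_pair_def)
  then show "convex_in K (P - E)"
    by (rule convex_in_closed_diff)
qed (fact assms(3))

theorem theorem14:
  fixes K :: "'v set set"
    and \<V> \<V>' :: "'v set set set"
    and S V A :: "'v set set"
    and F :: "'f::{field,finite} itself"
  assumes "finite_simplicial_complex K"
    and "multivector_field K \<V>"
    and "isolated_invariant_set F K \<V> S"
    and "atomic_coarsening K \<V> \<V>'"
    and "V \<in> \<V>' - \<V>"
    and "V \<inter> S \<noteq> {}"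
    and "\<not> V \<subseteq> S"
    and "A = compatible_convex_hull K \<V>' (S \<union> V)"
    and "S \<noteq> Inv F K \<V> A"
  shows "\<not> (\<exists>S'. isolated_invariant_set F K \<V>' S' \<and>
                (\<exists>P E. index_pair F K \<V> S P E \<and> index_pair F K \<V>' S' P E))"
proof
  assume "\<exists>S'. isolated_invariant_set F K \<V>' S' \<and>
                (\<exists>P E. index_pair F K \<V> S P E \<and> index_pair F K \<V>' S' P E)"
  then obtain S' P E where PE: "index_pair F K \<V> S P E" and PE': "index_pair F K \<V>' S' P E"
    by blast
  have \<V>': "multivector_field K \<V>'"
    using assms(4) unfolding atomic_coarsening_def by blast
  have S: "S = Inv F K \<V> (P - E)"
    using PE by (simp add: index_pair_def)
  then have "S \<subseteq> P - E"
    using Inv_subset[of F K \<V> "P - E"] by simp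
  moreover obtain \<sigma> where "\<sigma> \<in> V" "\<sigma> \<in> S"
    using assms(6) by blast
  \<comment> \<open>\<open>V\<close> is a multivector of \<open>\<V>'\<close> but not of
    \<open>\<V>\<close>, so the pair has to be used under \<open>\<V>'\<close> here.\<close>
  ultimately have "V \<subseteq> P - E"
    using index_pair_multivector_subset[OF \<V>' PE', of V \<sigma>] assms(5) by blast
  with \<open>S \<subseteq> P - E\<close> have "A \<subseteq> P - E"
    unfolding assms(8) by (intro compatible_convex_hull_subset_index_pair_diff[OF \<V>' PE']) simp
  \<comment> \<open>Back to \<open>\<V>\<close>: \<open>S\<close> is the invariant part of the same
    \<open>P - E\<close> under the finer field.\<close>
  then have "Inv F K \<V> A \<subseteq> S"
    by (subst S) (rule Inv_mono)
  moreover have "S \<subseteq> A"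
    using compatible_convex_hull_superset[of "S \<union> V"] unfolding assms(8) by blast
  then have "Inv F K \<V> S \<subseteq> Inv F K \<V> A"
    by (rule Inv_mono)
  then have "S \<subseteq> Inv F K \<V> A"
    using assms(3) by (simp add: isolated_invariant_set_def invariant_set_def)
  ultimately show False
    using assms(9) by blast
qed

end
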